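(* Let $(P_n)_{n\in\mathbb N_-}$ be a sequence of infinite stochastic matrices, with $p_n(i,j)$, $i,j\in\mathbb N$, the entries of $P_n$. Assume that there exists an infinite set $V\subset\mathbb N_-$ such that for any $n\in V$ and any $\varepsilon>0$ there exists an $N_\varepsilon(n)>0$ such that for any $i\in\mathbb N$ $$\sum_{k=1}^{N_\varepsilon(n)}p_{n-1}(i,k)\ge 1-\varepsilon .$$ Then there exists at least one sequence $(m_n)_{n\in\mathbb Z_-}\subset D$ such that $m_{n+1}=P_n(m_n)$ for every $n\in\mathbb N_-$.
   Context: $\mathbb N=\{1,2,\dots\}$, $\mathbb Z_-=\{\dots,-2,-1,0\}$, $\mathbb N_-=\{\dots,-2,-1\}$. $\ell^1$ is the space of absolutely summable real sequences $m=(m(1),m(2),\dots)$ with norm $\|m\|=\sum_{i=1}^\infty|m(i)|$, and $D=\{m\in\ell^1:\|m\|=1,\ m(i)\ge 0\text{ for each }i\}$ is the set of probability measures on $\mathbb N$. An infinite stochastic matrix is a matrix $P=(p(i,j))_{i,j\in\mathbb N}$ all of whose rows belong to $D$; it is identified with the linear map $P:\ell^1\to\ell^1$ given by $(P(m))(j)=\sum_{i=1}^\infty m(i)p(i,j)$. *)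

theory Defs
  imports "HOL-Analysis.Analysis"
begin

text \<open>
  Sequences are indexed by the positive integers \<open>{1..}\<close>. A real sequence is represented
  by a function on \<^typ>\<open>nat\<close> that vanishes at the unused index \<open>0\<close>, so that equality of
  functions is equality of sequences.
\<close>

definition l1 :: "(nat \<Rightarrow> real) set" where
  "l1 = {m. m 0 = 0 \<and> (\<lambda>i. \<bar>m i\<bar>) summable_on {1..}}"

definition l1_norm :: "(nat \<Rightarrow> real) \<Rightarrow> real" where
  "l1_norm m = (\<Sum>\<^sub>\<infinity>i\<in>{1..}. \<bar>m i\<bar>)"

definition prob_vectors :: "(nat \<Rightarrow> real) set" where
  "prob_vectors = {m \<in> l1. l1_norm m = 1 \<and> (\<forall>i\<ge>1. m i \<ge> 0)}"

definition inf_stochastic :: "(nat \<Rightarrow> nat \<Rightarrow> real) \<Rightarrow> bool" where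
  "inf_stochastic p \<longleftrightarrow> (\<forall>i\<ge>1. p i \<in> prob_vectors)"

text \<open>
  The action of a matrix on row vectors. If \<open>p\<close> is stochastic, then \<open>p i 0 = 0\<close> for
  \<open>i \<ge> 1\<close>, so the result again vanishes at the index \<open>0\<close>.
\<close>

definition matrix_map :: "(nat \<Rightarrow> nat \<Rightarrow> real) \<Rightarrow> (nat \<Rightarrow> real) \<Rightarrow> (nat \<Rightarrow> real)" where
  "matrix_map p m = (\<lambda>j. \<Sum>\<^sub>\<infinity>i\<in>{1..}. m i * p i j)"

end

theory Submission
  imports Defs
begin

text \<open>
  Start the chain at a remote time \<open>-k\<close> in a point mass and push it forward. Since all entries
  lie in \<open>[0,1]\<close>, Tychonoff's theorem yields a subsequence of starting times along which the
  distributions converge entrywise at every time \<open>n \<le> 0\<close>.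

  An entrywise limit of probability vectors can lose mass at infinity. The hypothesis forbids this
  at the times \<open>n \<in> V\<close>: there, every distribution that arose from a step of the chain gives mass
  at least \<open>1 - \<epsilon>\<close> to one and the same finite set, whatever the distribution before the step
  (\<open>matrix_map_tight\<close>), so that the limit is a probability vector (\<open>prob_vectors_limit_tight\<close>).
  Once no mass is lost at time \<open>n\<close>, entrywise convergence at \<open>n\<close> already is convergence against
  bounded functions (\<open>prob_vectors_tendsto_pairing\<close>), so the limit at time \<open>n + 1\<close> is the image
  under \<open>P n\<close> of the limit at time \<open>n\<close>, and hence a probability vector as well. As \<open>V\<close> is
  unbounded below, each time can be reached by forward steps from some \<open>n \<in> V\<close>.
\<close>

section \<open>Stochastic matrices acting on probability vectors\<close>

lemma prob_vectors_iff:
  "m \<in> prob_vectors \<longleftrightarrow> m 0 = 0 \<and> (\<forall>i\<ge>1. m i \<ge> 0) \<and> (m has_sum 1) {1..}"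
proof (cases "\<forall>i\<ge>1. m i \<ge> 0")
  case True
  then have eq: "\<bar>m i\<bar> = m i" if "i \<in> {1..}" for i
    using that by auto
  have "(\<lambda>i. \<bar>m i\<bar>) summable_on {1..} \<longleftrightarrow> m summable_on {1..}"
    by (rule summable_on_cong) (rule eq)
  moreover have "(\<Sum>\<^sub>\<infinity>i\<in>{1..}. \<bar>m i\<bar>) = infsum m {1..}"
    by (rule infsum_cong) (rule eq)
  ultimately show ?thesis
    using True unfolding prob_vectors_def l1_def l1_norm_def
    by (auto simp: has_sum_infsum summable_on_def dest: infsumI)
      (metis has_sum_infsum summable_on_def)
qed (auto simp: prob_vectors_def)

lemma prob_vectors_nonneg:
  assumes "m \<in> prob_vectors"
  shows "m i \<ge> 0"
  using assms by (cases "i = 0") (auto simp: prob_vectors_iff)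

lemma prob_vectors_sum_le_1:
  assumes "m \<in> prob_vectors" "finite F" "F \<subseteq> {1..}"
  shows "sum m F \<le> 1"
proof (rule finite_sum_le_has_sum)
  show "(m has_sum 1) {1..}"
    using assms(1) by (simp add: prob_vectors_iff)
qed (use assms prob_vectors_nonneg in auto)

lemma prob_vectors_le_1:
  assumes "m \<in> prob_vectors"
  shows "m i \<le> 1"
  using prob_vectors_sum_le_1[OF assms, of "{i}"] assms
  by (cases "i = 0") (auto simp: prob_vectors_iff)

lemma prob_vectors_summable_mult:
  assumes "m \<in> prob_vectors" and "\<And>i. i \<ge> 1 \<Longrightarrow> 0 \<le> f i" and "\<And>i. i \<ge> 1 \<Longrightarrow> f i \<le> 1"
  shows "(\<lambda>i. m i * f i) summable_on {1..}"
proof (rule summable_on_comparison_test)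
  show "m summable_on {1..}"
    using assms(1) by (auto simp: prob_vectors_iff summable_on_def)
qed (use assms prob_vectors_nonneg[OF assms(1)] in \<open>auto simp: mult_left_le\<close>)

lemma inf_stochasticD: "inf_stochastic p \<Longrightarrow> i \<ge> 1 \<Longrightarrow> p i \<in> prob_vectors"
  by (simp add: inf_stochastic_def)

lemma matrix_map_nonneg:
  assumes "inf_stochastic p" "m \<in> prob_vectors"
  shows "matrix_map p m j \<ge> 0"
  unfolding matrix_map_def
  by (intro infsum_nonneg mult_nonneg_nonneg prob_vectors_nonneg[OF assms(2)]
      prob_vectors_nonneg[OF inf_stochasticD[OF assms(1)]]) auto

text \<open>
  Tonelli's theorem for the nonnegative double family \<open>m i * p i j\<close>: the image gives to \<open>J\<close> the
  average of the masses that the rows give to \<open>J\<close>. The choice of \<open>J\<close> as the whole index set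
  shows that mass is preserved, and finite intervals give tightness.
\<close>

lemma matrix_map_has_sum:
  assumes p: "inf_stochastic p" and m: "m \<in> prob_vectors" and "J \<subseteq> {1..}"
    and row: "\<And>i. i \<ge> 1 \<Longrightarrow> (p i has_sum r i) J"
    and avg: "((\<lambda>i. m i * r i) has_sum c) {1..}"
  shows "(matrix_map p m has_sum c) J"
proof -
  let ?f = "\<lambda>(i,j). m i * p i j"
  have nn: "m i * p i j \<ge> 0" if "i \<ge> 1" for i j
    using prob_vectors_nonneg[OF m] prob_vectors_nonneg[OF inf_stochasticD[OF p that]] by simp
  have inner: "((\<lambda>j. ?f (i, j)) has_sum m i * r i) J" if "i \<in> {1..}" for i
    using row[of i] that by (auto intro!: has_sum_cmult_right)
  have "?f summable_on ({1..} \<times> J)"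
    using avg nn by (intro summable_on_SigmaI[OF inner]) (auto simp: summable_on_def)
  then have "(?f has_sum c) ({1..} \<times> J)"
    by (intro has_sum_SigmaI[OF inner avg])
  then have sw: "((\<lambda>(j,i). m i * p i j) has_sum c) (J \<times> {1..})"
    by (subst (asm) has_sum_swap) (simp add: case_prod_unfold)
  have col: "((\<lambda>i. (\<lambda>(j,i). m i * p i j) (j, i)) has_sum matrix_map p m j) {1..}" for j
  proof -
    have "(\<lambda>i. m i * p i j) summable_on {1..}"
      using prob_vectors_nonneg[OF inf_stochasticD[OF p]] prob_vectors_le_1[OF inf_stochasticD[OF p]]
      by (intro prob_vectors_summable_mult[OF m]) auto
    then show ?thesis
      by (simp add: matrix_map_def)
  qed
  show ?thesis
    by (rule has_sum_SigmaD[OF sw col])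
qed

lemma matrix_map_prob_vectors:
  assumes p: "inf_stochastic p" and m: "m \<in> prob_vectors"
  shows "matrix_map p m \<in> prob_vectors"
proof -
  have "matrix_map p m 0 = 0"
    unfolding matrix_map_def
    by (rule infsum_0) (use p in \<open>auto simp: inf_stochastic_def prob_vectors_iff\<close>)
  moreover have "(matrix_map p m has_sum 1) {1..}"
    using p m by (intro matrix_map_has_sum[where r = "\<lambda>_. 1"])
      (auto simp: inf_stochastic_def prob_vectors_iff)
  ultimately show ?thesis
    using matrix_map_nonneg[OF p m] by (simp add: prob_vectors_iff)
qed

text \<open>
  A lower bound on the mass of \<open>{1..N}\<close> that is uniform over the rows passes to every average of
  the rows.
\<close>

lemma matrix_map_tight:
  assumes p: "inf_stochastic p" and m: "m \<in> prob_vectors"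
    and rows: "\<And>i. i \<ge> 1 \<Longrightarrow> (\<Sum>k=1..N. p i k) \<ge> c"
  shows "(\<Sum>k=1..N. matrix_map p m k) \<ge> c"
proof -
  define r where "r i = (\<Sum>k=1..N. p i k)" for i
  have r: "0 \<le> r i" "r i \<le> 1" if "i \<ge> 1" for i
    using prob_vectors_nonneg[OF inf_stochasticD[OF p that]]
      prob_vectors_sum_le_1[OF inf_stochasticD[OF p that], of "{1..N}"]
    unfolding r_def by (auto intro!: sum_nonneg)
  obtain s where s: "((\<lambda>i. m i * r i) has_sum s) {1..}"
    using prob_vectors_summable_mult[OF m, of r] r unfolding summable_on_def by blast
  have "(matrix_map p m has_sum s) {1..N}"
    by (rule matrix_map_has_sum[OF p m _ _ s]) (auto simp: r_def intro!: has_sum_finite)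
  then have "(\<Sum>k=1..N. matrix_map p m k) = s"
    using has_sum_finite[of "{1..N}" "matrix_map p m"] has_sum_unique by blast
  moreover have "((\<lambda>i. m i * c) has_sum 1 * c) {1..}"
    using m by (intro has_sum_cmult_left) (simp add: prob_vectors_iff)
  then have "1 * c \<le> s"
    by (rule has_sum_mono[OF _ s])
      (use rows prob_vectors_nonneg[OF m] in \<open>auto simp: r_def intro!: mult_left_mono\<close>)
  ultimately show ?thesis
    by simp
qed

section \<open>Entrywise limits of probability vectors\<close>

text \<open>
  A lower bound on a finite sum survives the entrywise limit. Bounds arbitrarily close to \<open>1\<close>
  therefore leave no room for mass to escape.
\<close>

lemma prob_vectors_limit_tight:
  assumes lim: "\<And>j. ((\<lambda>k. x k j) \<longlongrightarrow> L j) F" and nt: "F \<noteq> bot"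
    and x: "\<forall>\<^sub>F k in F. x k \<in> prob_vectors"
    and tight: "\<And>\<epsilon>. \<epsilon> > (0::real) \<Longrightarrow> \<exists>N::nat. \<forall>\<^sub>F k in F. (\<Sum>j=1..N. x k j) \<ge> 1 - \<epsilon>"
  shows "L \<in> prob_vectors"
proof -
  have nn: "L j \<ge> 0" for j
    by (rule tendsto_lowerbound[OF lim _ nt]) (use x in \<open>auto elim: eventually_mono prob_vectors_nonneg\<close>)
  have fin: "((\<lambda>k. sum (x k) A) \<longlongrightarrow> sum L A) F" for A
    by (intro tendsto_sum lim)
  have le: "sum L A \<le> 1" if "finite A" "A \<subseteq> {1..}" for A
  proof (rule tendsto_upperbound[OF fin _ nt])
    show "\<forall>\<^sub>F k in F. sum (x k) A \<le> 1"
      using x by eventually_elim (rule prob_vectors_sum_le_1[OF _ that])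
  qed
  have "L summable_on {1..}"
    using nn le by (intro nonneg_bdd_above_summable_on) (auto simp: bdd_above_def)
  then obtain s where s: "(L has_sum s) {1..}"
    by (auto simp: summable_on_def)
  have "s \<le> 1"
    by (rule has_sum_le_finite_sums[OF s le])
  moreover have "1 \<le> s"
  proof (rule field_le_epsilon)
    fix \<epsilon> :: real assume "\<epsilon> > 0"
    from tight[OF this] obtain N where "\<forall>\<^sub>F k in F. (\<Sum>j=1..N. x k j) \<ge> 1 - \<epsilon>"
      by blast
    then have "1 - \<epsilon> \<le> (\<Sum>j=1..N. L j)"
      by (rule tendsto_lowerbound[OF fin _ nt])
    also have "\<dots> \<le> s"
      by (rule finite_sum_le_has_sum[OF s]) (use nn in auto)
    finally show "1 \<le> s + \<epsilon>"
      by simp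
  qed
  moreover have "((\<lambda>k. x k 0) \<longlongrightarrow> 0) F"
    by (rule tendsto_eventually) (use x in \<open>auto elim: eventually_mono simp: prob_vectors_iff\<close>)
  then have "L 0 = 0"
    using tendsto_unique[OF nt lim] by blast
  ultimately show ?thesis
    using nn s by (simp add: prob_vectors_iff)
qed

text \<open>
  Fatou's inequality: every value below the limit sum is exceeded by a finite partial sum, and
  finite partial sums converge.
\<close>

lemma prob_vectors_eventually_pairing_gt:
  assumes lim: "\<And>j. ((\<lambda>k. x k j) \<longlongrightarrow> L j) F"
    and x: "\<forall>\<^sub>F k in F. x k \<in> prob_vectors" and L: "L \<in> prob_vectors"
    and f: "\<And>i. i \<ge> 1 \<Longrightarrow> 0 \<le> f i" "\<And>i. i \<ge> 1 \<Longrightarrow> f i \<le> 1"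
    and a: "a < (\<Sum>\<^sub>\<infinity>i\<in>{1..}. L i * f i)"
  shows "\<forall>\<^sub>F k in F. a < (\<Sum>\<^sub>\<infinity>i\<in>{1..}. x k i * f i)"
proof -
  have sum: "((\<lambda>i. L i * f i) has_sum (\<Sum>\<^sub>\<infinity>i\<in>{1..}. L i * f i)) {1..}"
    using prob_vectors_summable_mult[OF L f] by simp
  obtain A where A: "finite A" "A \<subseteq> {1..}" "a < (\<Sum>i\<in>A. L i * f i)"
    using has_sum_le_finite_sums[OF sum, of a] a by (meson not_le)
  have "((\<lambda>k. \<Sum>i\<in>A. x k i * f i) \<longlongrightarrow> (\<Sum>i\<in>A. L i * f i)) F"
    by (intro tendsto_intros lim)
  then have "\<forall>\<^sub>F k in F. a < (\<Sum>i\<in>A. x k i * f i)"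
    using A(3) by (rule order_tendstoD)
  with x show ?thesis
  proof eventually_elim
    case (elim k)
    have "(\<Sum>i\<in>A. x k i * f i) \<le> (\<Sum>\<^sub>\<infinity>i\<in>{1..}. x k i * f i)"
      using A prob_vectors_nonneg[OF elim(1)] f
      by (intro finite_sum_le_infsum prob_vectors_summable_mult[OF elim(1)]) auto
    with elim show ?case
      by simp
  qed
qed

text \<open>
  Scheffe's phenomenon: Fatou's inequality for \<open>f\<close> bounds the limit from one side, and Fatou's
  inequality for \<open>1 - f\<close> from the other, because neither the sequence nor the limit loses mass.
\<close>

lemma prob_vectors_tendsto_pairing:
  assumes lim: "\<And>j. ((\<lambda>k. x k j) \<longlongrightarrow> L j) F"
    and x: "\<forall>\<^sub>F k in F. x k \<in> prob_vectors" and L: "L \<in> prob_vectors"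
    and f: "\<And>i. i \<ge> 1 \<Longrightarrow> 0 \<le> f i" "\<And>i. i \<ge> 1 \<Longrightarrow> f i \<le> 1"
  shows "((\<lambda>k. \<Sum>\<^sub>\<infinity>i\<in>{1..}. x k i * f i) \<longlongrightarrow> (\<Sum>\<^sub>\<infinity>i\<in>{1..}. L i * f i)) F"
proof (rule order_tendstoI)
  fix a assume "a < (\<Sum>\<^sub>\<infinity>i\<in>{1..}. L i * f i)"
  then show "\<forall>\<^sub>F k in F. a < (\<Sum>\<^sub>\<infinity>i\<in>{1..}. x k i * f i)"
    by (intro prob_vectors_eventually_pairing_gt[OF lim x L]) (use f in auto)
next
  have compl: "(\<Sum>\<^sub>\<infinity>i\<in>{1..}. m i * (1 - f i)) = 1 - (\<Sum>\<^sub>\<infinity>i\<in>{1..}. m i * f i)"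
    if m: "m \<in> prob_vectors" for m
  proof -
    have "(\<Sum>\<^sub>\<infinity>i\<in>{1..}. m i * (1 - f i)) + (\<Sum>\<^sub>\<infinity>i\<in>{1..}. m i * f i)
        = (\<Sum>\<^sub>\<infinity>i\<in>{1..}. m i * (1 - f i) + m i * f i)"
      by (intro infsum_add[symmetric] prob_vectors_summable_mult[OF m]) (use f in auto)
    also have "\<dots> = infsum m {1..}"
      by (simp add: algebra_simps)
    also have "\<dots> = 1"
      using m by (simp add: prob_vectors_iff infsumI)
    finally show ?thesis
      by simp
  qed
  fix a assume "(\<Sum>\<^sub>\<infinity>i\<in>{1..}. L i * f i) < a"
  then have "1 - a < (\<Sum>\<^sub>\<infinity>i\<in>{1..}. L i * (1 - f i))"
    using compl[OF L] by simp
  then have "\<forall>\<^sub>F k in F. 1 - a < (\<Sum>\<^sub>\<infinity>i\<in>{1..}. x k i * (1 - f i))"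
    by (intro prob_vectors_eventually_pairing_gt[OF lim x L]) (use f in auto)
  with x show "\<forall>\<^sub>F k in F. (\<Sum>\<^sub>\<infinity>i\<in>{1..}. x k i * f i) < a"
  proof eventually_elim
    case (elim k)
    with compl[OF elim(1)] show ?case
      by linarith
  qed
qed

lemma matrix_map_tendsto:
  assumes "\<And>j. ((\<lambda>k. x k j) \<longlongrightarrow> L j) F" "\<forall>\<^sub>F k in F. x k \<in> prob_vectors"
    "L \<in> prob_vectors" and p: "inf_stochastic p"
  shows "((\<lambda>k. matrix_map p (x k) j) \<longlongrightarrow> matrix_map p L j) F"
  unfolding matrix_map_def
  by (rule prob_vectors_tendsto_pairing[OF assms(1-3)])
    (use prob_vectors_nonneg[OF inf_stochasticD[OF p]] prob_vectors_le_1[OF inf_stochasticD[OF p]]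
     in auto)

text \<open>
  A product of intervals is compact by Tychonoff's theorem. Over a countable index set the product
  topology is first countable, so that compactness yields convergent subsequences.
\<close>

lemma pointwise_convergent_subsequence:
  fixes g :: "nat \<Rightarrow> 'a::countable \<Rightarrow> real"
  assumes "\<And>k c. g k c \<in> {a..b}"
  obtains l r where "strict_mono (r :: nat \<Rightarrow> nat)" "\<And>c. (\<lambda>k. g (r k) c) \<longlonglongrightarrow> l c"
proof -
  have "compactin (product_topology (\<lambda>_::'a. euclidean) UNIV) (PiE UNIV (\<lambda>_. {a..b::real}))"
    by (subst compactin_PiE) simp
  then have "compact (PiE UNIV (\<lambda>_::'a. {a..b::real}))"
    by (simp add: euclidean_product_topology)
  then have "seq_compact (PiE UNIV (\<lambda>_::'a. {a..b::real}))"
    by (rule compact_imp_seq_compact)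
  then obtain l r where r: "strict_mono (r :: nat \<Rightarrow> nat)" and l: "(g \<circ> r) \<longlonglongrightarrow> l"
    by (rule seq_compactE[where f = g]) (use assms in auto)
  have "(\<lambda>k. g (r k) c) \<longlonglongrightarrow> l c" for c
  proof -
    have "continuous_on UNIV (\<lambda>h::'a \<Rightarrow> real. h c)"
      by (rule continuous_on_product_coordinates)
    then have "isCont (\<lambda>h::'a \<Rightarrow> real. h c) l"
      using continuous_on_eq_continuous_at[OF open_UNIV] by blast
    from isCont_tendsto_compose[OF this l] show ?thesis
      by (simp add: o_def)
  qed
  with r show ?thesis
    by (rule that)
qed

section \<open>Chains started in the remote past\<close>

text \<open>
  The distribution at time \<open>s + t\<close> of the chain that sits in the state \<open>1\<close> at time \<open>s\<close>.
\<close>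

fun chain_from :: "(int \<Rightarrow> nat \<Rightarrow> nat \<Rightarrow> real) \<Rightarrow> int \<Rightarrow> nat \<Rightarrow> nat \<Rightarrow> real" where
  "chain_from P s 0 = (\<lambda>i. if i = 1 then 1 else 0)"
| "chain_from P s (Suc t) = matrix_map (P (s + int t)) (chain_from P s t)"

lemma chain_from_prob_vectors:
  assumes "\<And>n. n < 0 \<Longrightarrow> inf_stochastic (P n)" and "s + int t \<le> 0"
  shows "chain_from P s t \<in> prob_vectors"
  using assms(2)
proof (induction t)
  case 0
  have "((\<lambda>i. if i = 1 then 1 else 0 :: real) has_sum 1) {1::nat}"
    by (auto intro: has_sum_finiteI)
  then have "((\<lambda>i. if i = 1 then 1 else 0 :: real) has_sum 1) {1::nat..}"
    by (subst (asm) has_sum_cong_neutral) auto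
  then show ?case
    by (auto simp: prob_vectors_iff)
next
  case (Suc t)
  then show ?case
    using assms(1)[of "s + int t"] by (auto intro: matrix_map_prob_vectors)
qed

theorem theorem5:
  fixes P :: "int \<Rightarrow> nat \<Rightarrow> nat \<Rightarrow> real" and V :: "int set"
  assumes "\<And>n. n < 0 \<Longrightarrow> inf_stochastic (P n)"
    and "V \<subseteq> {..<0}" and "infinite V"
    and "\<And>n \<epsilon>. n \<in> V \<Longrightarrow> \<epsilon> > (0::real) \<Longrightarrow>
           \<exists>N::nat. N > 0 \<and> (\<forall>i\<ge>1. (\<Sum>k=1..N. P (n - 1) i k) \<ge> 1 - \<epsilon>)"
  shows "\<exists>m :: int \<Rightarrow> nat \<Rightarrow> real.
           (\<forall>n\<le>0. m n \<in> prob_vectors) \<and> (\<forall>n<0. m (n + 1) = matrix_map (P n) (m n))"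
proof -
  note stoch = assms(1)
  \<comment> \<open>Before its starting time \<open>-k\<close>, the truncation in \<open>nat\<close> keeps the chain in its initial state.\<close>
  define x where "x k n = chain_from P (- int k) (nat (n + int k))" for k n
  have x_prob: "x k n \<in> prob_vectors" if "n \<le> 0" for k n
    unfolding x_def by (rule chain_from_prob_vectors) (use stoch that in auto)
  have x_step: "x k (n + 1) = matrix_map (P n) (x k n)" if "- int k \<le> n" for k n
  proof -
    have "nat (n + 1 + int k) = Suc (nat (n + int k))"
      using that by simp
    then show ?thesis
      using that by (simp add: x_def)
  qed
  \<comment> \<open>Times \<open>n \<le> 0\<close> are indexed by \<open>nat (- n)\<close>, as nothing bounds the entries after time \<open>0\<close>.\<close>
  define g where "g k = (\<lambda>(t, j). x k (- int t) j)" for k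
  have "g k c \<in> {0..1}" for k c
    using prob_vectors_nonneg[OF x_prob] prob_vectors_le_1[OF x_prob]
    by (cases c) (auto simp: g_def)
  from pointwise_convergent_subsequence[of g, OF this]
  obtain l r where r: "strict_mono (r :: nat \<Rightarrow> nat)"
    and l: "\<And>c. (\<lambda>k. g (r k) c) \<longlonglongrightarrow> l c"
    by blast
  define L where "L n j = l (nat (- n), j)" for n j
  have lim: "(\<lambda>k. x (r k) n j) \<longlonglongrightarrow> L n j" if "n \<le> 0" for n j
    using l[of "(nat (- n), j)"] that by (simp add: g_def L_def)
  have ev_prob: "\<forall>\<^sub>F k in sequentially. x (r k) n \<in> prob_vectors" if "n \<le> 0" for n
    using x_prob[OF that] by simp
  have ev_step: "\<forall>\<^sub>F k in sequentially. x (r k) (n + 1) = matrix_map (P n) (x (r k) n)" for n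
  proof -
    have "\<forall>\<^sub>F k in sequentially. nat (- n) \<le> r k"
      using filterlim_subseq[OF r] by (simp add: filterlim_at_top)
    then show ?thesis
      by eventually_elim (rule x_step, simp)
  qed

  have L_step: "L (n + 1) = matrix_map (P n) (L n)" if n: "n < 0" and Ln: "L n \<in> prob_vectors" for n
  proof
    fix j
    have "(\<lambda>k. matrix_map (P n) (x (r k) n) j) \<longlonglongrightarrow> matrix_map (P n) (L n) j"
      by (rule matrix_map_tendsto) (use n Ln lim ev_prob stoch in auto)
    moreover have "\<forall>\<^sub>F k in sequentially. matrix_map (P n) (x (r k) n) j = x (r k) (n + 1) j"
      using ev_step[of n] by eventually_elim simp
    ultimately have "(\<lambda>k. x (r k) (n + 1) j) \<longlonglongrightarrow> matrix_map (P n) (L n) j"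
      by (rule Lim_transform_eventually)
    then show "L (n + 1) j = matrix_map (P n) (L n) j"
      using lim[of "n + 1" j] n LIMSEQ_unique by auto
  qed

  have L_V: "L v \<in> prob_vectors" if v: "v \<in> V" for v
  proof (rule prob_vectors_limit_tight[where F = sequentially and x = "\<lambda>k. x (r k) v"])
    have "v < 0"
      using v assms(2) by auto
    then have "v \<le> 0"
      by simp
    then show "(\<lambda>k. x (r k) v j) \<longlonglongrightarrow> L v j" for j
      by (rule lim)
    show "\<forall>\<^sub>F k in sequentially. x (r k) v \<in> prob_vectors"
      by (rule ev_prob) fact
    fix \<epsilon> :: real assume "\<epsilon> > 0"
    from assms(4)[OF v this] obtain N
      where N: "\<forall>i\<ge>1. (\<Sum>k=1..N. P (v - 1) i k) \<ge> 1 - \<epsilon>"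
      by blast
    have "\<forall>\<^sub>F k in sequentially. (\<Sum>j=1..N. x (r k) v j) \<ge> 1 - \<epsilon>"
      using ev_step[of "v - 1"]
    proof eventually_elim
      case (elim k)
      have "(\<Sum>j=1..N. matrix_map (P (v - 1)) (x (r k) (v - 1)) j) \<ge> 1 - \<epsilon>"
        by (rule matrix_map_tight) (use \<open>v < 0\<close> stoch x_prob N in auto)
      with elim show ?case
        by simp
    qed
    then show "\<exists>N. \<forall>\<^sub>F k in sequentially. (\<Sum>j=1..N. x (r k) v j) \<ge> 1 - \<epsilon>" ..
  qed simp

  have L_prob: "L n \<in> prob_vectors" if n: "n \<le> 0" for n
  proof -
    obtain v where v: "v \<in> V" "v \<le> n"
    proof (rule ccontr)
      assume "\<not> thesis"
      then have "V \<subseteq> {n..<0}"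
        using that assms(2) by force
      with \<open>infinite V\<close> show False
        using finite_subset by blast
    qed
    from v(2) n show ?thesis
    proof (induction rule: int_ge_induct)
      case base
      show ?case by (rule L_V[OF v(1)])
    next
      case (step i)
      then show ?case
        using L_step[of i] matrix_map_prob_vectors[OF stoch[of i], of "L i"] by simp
    qed
  qed
  show ?thesis
    using L_prob L_step by (intro exI[of _ L]) auto
qed

end
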